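(* Let $A\in\mathbb{R}^{n\times n}$ be symmetric and positive definite, let $\mathbf{b}\in\mathbb{R}^n$, and let $f(\mathbf{x})=\tfrac12\mathbf{x}^TA\mathbf{x}-\mathbf{b}^T\mathbf{x}$. Run Algorithm 2 (with exact line search) on $f$ and run Algorithm Linear-CG on $(A,\mathbf{b})$ (both defined in the context), from the same starting point $\mathbf{x}_0\in\mathbb{R}^n$. Then the two algorithms are equivalent: they generate the same iterates $\mathbf{x}_k$, and for every $k\ge 1$ such that $\mathbf{r}_0,\dots,\mathbf{r}_{k-1}$ are all nonzero, $$\mathbf{p}_k=\mathbf{r}_{k-1},\qquad \mathbf{m}_k=\mathbf{n}_k,\qquad \mathbf{g}_k=\mathbf{r}_k,$$ and the step length $\alpha_k$ of Algorithm 2 equals the step length $\alpha_k$ of Algorithm Linear-CG.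
   Context: Algorithm 2 (for a differentiable $f:\mathbb{R}^n\to\mathbb{R}$ and starting point $\mathbf{x}_0$). For $k=1,2,\dots$, as long as $\mathbf{p}_k\neq 0$: - $\mathbf{p}_k:=-l_{k-1}^T\circ\cdots\circ l_1^T(\nabla f(\mathbf{x}_{k-1}))$; - $\mathbf{m}_k:=l_1\circ\cdots\circ l_{k-1}(\mathbf{p}_k)$; - $\alpha_k:=\operatorname{argmin}\{f(\mathbf{x}_{k-1}+\alpha\mathbf{m}_k):\alpha\ge 0\}$ (exact line search); - $\mathbf{x}_k:=\mathbf{x}_{k-1}+\alpha_k\mathbf{m}_k$; - $\mathbf{g}_k:=-l_{k-1}^T\circ\cdots\circ l_1^T(\nabla f(\mathbf{x}_k))$; - $l_k:\mathbb{R}^n\to\mathbb{R}^n$ is the linear map $l_k(\mathbf{x})=\left(I+\mathbf{p}_k\mathbf{g}_k^T/\|\mathbf{p}_k\|^2\right)\mathbf{x}$, and $l_k^T$ is its transpose. Empty compositions (for $k=1$) are the identity; $I$ is the $n\times n$ identity matrix and $\|\cdot\|$ is the Euclidean norm. Algorithm Linear-CG (for $A,\mathbf{b}$ and starting point $\mathbf{x}_0$). Set $\mathbf{r}_0:=\mathbf{b}-A\mathbf{x}_0$. For $k=1,2,\dots$, as long as $\mathbf{r}_{k-1}\ne 0$: - if $k=1$, $\mathbf{n}_1:=\mathbf{r}_0$; otherwise $\beta_k:=\mathbf{r}_{k-1}^T\mathbf{r}_{k-1}/(\mathbf{r}_{k-2}^T\mathbf{r}_{k-2})$ and $\mathbf{n}_k:=\beta_k\mathbf{n}_{k-1}+\mathbf{r}_{k-1}$;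 - $\alpha_k:=\mathbf{r}_{k-1}^T\mathbf{r}_{k-1}/(\mathbf{n}_k^TA\mathbf{n}_k)$; - $\mathbf{x}_k:=\mathbf{x}_{k-1}+\alpha_k\mathbf{n}_k$; - $\mathbf{r}_k:=\mathbf{r}_{k-1}-\alpha_kA\mathbf{n}_k$. *)

theory Defs
  imports "HOL-Analysis.Analysis"
begin

text \<open>Meaningful only where \<open>f\<close> is differentiable.\<close>

definition gradient :: "('a::real_inner \<Rightarrow> real) \<Rightarrow> 'a \<Rightarrow> 'a" where
  "gradient f x = (THE D. GDERIV f x :> D)"

definition outer :: "real ^ 'n \<Rightarrow> real ^ 'n \<Rightarrow> real ^ 'n ^ 'n" where
  "outer u v = (\<chi> i j. u $ i * v $ j)"

definition transpose_map :: "(real ^ 'n \<Rightarrow> real ^ 'n) \<Rightarrow> real ^ 'n \<Rightarrow> real ^ 'n" where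
  "transpose_map h = (\<lambda>v. transpose (matrix h) *v v)"

text \<open>\<open>comp_maps l k\<close> is \<open>l 1 \<circ> \<dots> \<circ> l (k - 1)\<close>, and \<open>comp_transposes l k\<close> composes the
  transposes in the opposite order, with that of \<open>l 1\<close> applied first.\<close>

definition comp_maps :: "(nat \<Rightarrow> real ^ 'n \<Rightarrow> real ^ 'n) \<Rightarrow> nat \<Rightarrow> real ^ 'n \<Rightarrow> real ^ 'n" where
  "comp_maps l k = foldr (\<circ>) (map l [1..<k]) id"

definition comp_transposes :: "(nat \<Rightarrow> real ^ 'n \<Rightarrow> real ^ 'n) \<Rightarrow> nat \<Rightarrow> real ^ 'n \<Rightarrow> real ^ 'n" where
  "comp_transposes l k = foldr (\<circ>) (map (\<lambda>j. transpose_map (l j)) (rev [1..<k])) id"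

text \<open>A run is given by total sequences, but the entries are constrained only at the steps
  the algorithm reaches; entries after termination (and unused entries at index 0) are arbitrary.
  In the first algorithm, step \<open>k\<close> computes \<open>p k\<close> whenever \<open>p 1, \<dots>, p (k - 1)\<close> are nonzero,
  and stops there if \<open>p k = 0\<close>.\<close>

definition algorithm2_run ::
  "(real ^ 'n \<Rightarrow> real) \<Rightarrow> real ^ 'n \<Rightarrow> (nat \<Rightarrow> real ^ 'n) \<Rightarrow> (nat \<Rightarrow> real ^ 'n) \<Rightarrow> (nat \<Rightarrow> real) \<Rightarrow>
   (nat \<Rightarrow> real ^ 'n) \<Rightarrow> (nat \<Rightarrow> real ^ 'n) \<Rightarrow> (nat \<Rightarrow> real ^ 'n \<Rightarrow> real ^ 'n) \<Rightarrow> bool" where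
  "algorithm2_run f x0 p m \<alpha> x g l \<longleftrightarrow>
     x 0 = x0 \<and>
     (\<forall>k\<ge>1. (\<forall>j\<in>{1..<k}. p j \<noteq> 0) \<longrightarrow>
        p k = - comp_transposes l k (gradient f (x (k - 1))) \<and>
        (p k \<noteq> 0 \<longrightarrow>
           m k = comp_maps l k (p k) \<and>
           is_arg_min (\<lambda>a. f (x (k - 1) + a *\<^sub>R m k)) (\<lambda>a. a \<ge> 0) (\<alpha> k) \<and>
           x k = x (k - 1) + \<alpha> k *\<^sub>R m k \<and>
           g k = - comp_transposes l k (gradient f (x k)) \<and>
           l k = (\<lambda>v. (mat 1 + (1 / (norm (p k))\<^sup>2) *\<^sub>R outer (p k) (g k)) *v v)))"

definition linear_CG_run ::
  "real ^ 'n ^ 'n \<Rightarrow> real ^ 'n \<Rightarrow> real ^ 'n \<Rightarrow> (nat \<Rightarrow> real) \<Rightarrow> (nat \<Rightarrow> real ^ 'n) \<Rightarrow> (nat \<Rightarrow> real) \<Rightarrow>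
   (nat \<Rightarrow> real ^ 'n) \<Rightarrow> (nat \<Rightarrow> real ^ 'n) \<Rightarrow> bool" where
  "linear_CG_run A b x0 \<beta> n \<alpha> x r \<longleftrightarrow>
     x 0 = x0 \<and> r 0 = b - A *v x0 \<and>
     (\<forall>k\<ge>1. (\<forall>j<k. r j \<noteq> 0) \<longrightarrow>
        (if k = 1 then n 1 = r 0
         else \<beta> k = (r (k - 1) \<bullet> r (k - 1)) / (r (k - 2) \<bullet> r (k - 2)) \<and>
              n k = \<beta> k *\<^sub>R n (k - 1) + r (k - 1)) \<and>
        \<alpha> k = (r (k - 1) \<bullet> r (k - 1)) / (n k \<bullet> (A *v n k)) \<and>
        x k = x (k - 1) + \<alpha> k *\<^sub>R n k \<and>
        r k = r (k - 1) - \<alpha> k *\<^sub>R (A *v n k))"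

end

theory Submission
  imports Defs
begin

text \<open>
  Every step reduces to the orthogonality of the CG residuals. Along a CG run
  \<open>r k = b - A *v x k\<close> is the negative gradient of \<open>f\<close> at \<open>x k\<close>, and the residuals are mutually
  orthogonal as long as none of them vanishes (\<open>orthogonality\<close>).

  Suppose that Algorithm 2 has agreed with CG so far, so that
  \<open>l j v = v + ((r j \<bullet> v) / (r (j - 1) \<bullet> r (j - 1))) *\<^sub>R r (j - 1)\<close>. The transpose of \<open>l j\<close> fixes every
  vector orthogonal to \<open>r (j - 1)\<close>, hence all later residuals; so pushing the gradient through the
  transposes does nothing, and \<open>p\<close> and \<open>g\<close> are plain residuals (\<open>comp_transposes_gradient\<close>). The
  map \<open>l j\<close> itself fixes every vector orthogonal to \<open>r j\<close>, so in \<open>m (k + 1)\<close> only the last factor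
  \<open>l k\<close> acts on \<open>r k\<close>; it adds the multiple of \<open>r (k - 1)\<close> given by the Fletcher--Reeves quotient,
  and the remaining factors turn \<open>r (k - 1)\<close> into \<open>m k\<close>. This is the CG recurrence for the
  directions (\<open>comp_maps_residual\<close>). Finally, on a parabola that descends at \<open>0\<close> the exact line
  search has the vertex as its only solution, and CG steps to this vertex
  (\<open>exact_line_search_iff\<close>).

  Induction on the step then shows that any two runs agree and stop together
  (\<open>algorithm2_run_unique\<close>, \<open>same_termination\<close>). Read as identities about a CG run alone, the same
  facts say that the data of the run satisfy the rules of Algorithm 2 (\<open>algorithm2_run_from_CG\<close>);
  this gives existence of a run of Algorithm 2, since CG is an explicit recursion.
\<close>

section \<open>The quadratic objective and exact line search\<close>

lemma GDERIV_unique: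
  assumes "GDERIV f x :> D" and "GDERIV f x :> E"
  shows "D = E"
proof -
  have "(\<lambda>h. h \<bullet> D) = (\<lambda>h. h \<bullet> E)"
    using assms has_derivative_unique unfolding gderiv_def by blast
  then show ?thesis by (metis inner_commute vector_eq_rdot)
qed

lemma symmetric_inner:
  fixes A :: "real ^ 'n ^ 'n"
  assumes "transpose A = A"
  shows "u \<bullet> (A *v v) = (A *v u) \<bullet> v"
  using assms by (metis dot_lmul_matrix transpose_matrix_vector)

lemma gradient_quadratic:
  fixes A :: "real ^ 'n ^ 'n"
  assumes "transpose A = A"
  shows "gradient (\<lambda>x. 1 / 2 * (x \<bullet> (A *v x)) - b \<bullet> x) x = A *v x - b"
proof -
  have "((\<lambda>x. 1 / 2 * (x \<bullet> (A *v x)) - b \<bullet> x) has_derivative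
          (\<lambda>h. 1 / 2 * (x \<bullet> (A *v h) + h \<bullet> (A *v x)) - b \<bullet> h)) (at x)"
    by (auto intro!: derivative_eq_intros bounded_linear_imp_has_derivative)
  moreover have "(\<lambda>h. 1 / 2 * (x \<bullet> (A *v h) + h \<bullet> (A *v x)) - b \<bullet> h) = (\<lambda>h. h \<bullet> (A *v x - b))"
    by (simp add: fun_eq_iff symmetric_inner[OF assms, of x] inner_diff_right inner_commute)
  ultimately have "GDERIV (\<lambda>x. 1 / 2 * (x \<bullet> (A *v x)) - b \<bullet> x) x :> A *v x - b"
    by (simp add: gderiv_def)
  then show ?thesis
    unfolding gradient_def by (blast intro: GDERIV_unique)
qed

text \<open>Completing the square: along \<open>d\<close> the objective is its value at the vertex \<open>a0\<close> plus a
  positive multiple of \<open>(a - a0)\<^sup>2\<close>, and \<open>d\<close> being a descent direction puts the vertex in the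
  admissible half-line.\<close>

lemma exact_line_search_quadratic:
  fixes A :: "real ^ 'n ^ 'n"
  assumes sym: "transpose A = A"
    and curvature: "d \<bullet> (A *v d) > 0"
    and descent: "d \<bullet> (b - A *v x) \<ge> 0"
    and f: "f = (\<lambda>x. 1 / 2 * (x \<bullet> (A *v x)) - b \<bullet> x)"
  shows "is_arg_min (\<lambda>a. f (x + a *\<^sub>R d)) (\<lambda>a. a \<ge> 0) a \<longleftrightarrow>
    a = (d \<bullet> (b - A *v x)) / (d \<bullet> (A *v d))"
proof -
  define c where "c = d \<bullet> (A *v d)"
  define a0 where "a0 = (d \<bullet> (b - A *v x)) / c"
  have "c > 0" "a0 \<ge> 0"
    using curvature descent by (auto simp: c_def a0_def)
  have "d \<bullet> (b - A *v x) = a0 * c"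
    using \<open>c > 0\<close> by (simp add: a0_def)
  then have slope: "d \<bullet> b = d \<bullet> (A *v x) + a0 * c"
    by (simp add: inner_diff_right)
  have cross: "x \<bullet> (A *v d) = d \<bullet> (A *v x)"
    by (simp add: symmetric_inner[OF sym, of x] inner_commute)
  have "f (x + t *\<^sub>R d) = f x + (c / 2) * ((t - a0)\<^sup>2 - a0\<^sup>2)" for t
    unfolding f
    by (simp add: matrix_vector_right_distrib matrix_vector_mult_scaleR inner_add_left
        inner_add_right inner_commute[of b] slope cross c_def[symmetric] power2_eq_square
        field_simps)
  then have "f (x + t *\<^sub>R d) < f (x + s *\<^sub>R d) \<longleftrightarrow> (t - a0)\<^sup>2 < (s - a0)\<^sup>2" for s t
    using \<open>c > 0\<close> by simp
  then have "is_arg_min (\<lambda>a. f (x + a *\<^sub>R d)) (\<lambda>a. a \<ge> 0) a \<longleftrightarrow>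
      a \<ge> 0 \<and> (\<forall>t\<ge>0. \<not> (t - a0)\<^sup>2 < (a - a0)\<^sup>2)"
    by (auto simp: is_arg_min_def)
  also have "\<dots> \<longleftrightarrow> a = a0"
    using \<open>a0 \<ge> 0\<close> by (force simp: not_less)
  finally show ?thesis by (simp add: a0_def c_def)
qed

section \<open>Rank-one factors and their compositions\<close>

definition rank_one_factor :: "real ^ 'n \<Rightarrow> real ^ 'n \<Rightarrow> real ^ 'n \<Rightarrow> real ^ 'n" where
  "rank_one_factor p g = (\<lambda>v. (mat 1 + (1 / (norm p)\<^sup>2) *\<^sub>R outer p g) *v v)"

lemma outer_mult_vector: "outer u v *v w = (v \<bullet> w) *\<^sub>R u"
  by (simp add: vec_eq_iff outer_def matrix_vector_mult_def inner_vec_def sum_distrib_left mult_ac)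

lemma rank_one_factor_apply:
  "rank_one_factor p g v = v + ((g \<bullet> v) / (p \<bullet> p)) *\<^sub>R p"
  by (simp add: rank_one_factor_def matrix_vector_mult_add_rdistrib outer_mult_vector
      scaleR_matrix_vector_assoc[symmetric] power2_norm_eq_inner)

lemma transpose_map_rank_one_factor:
  "transpose_map (rank_one_factor p g) v = v + ((p \<bullet> v) / (p \<bullet> p)) *\<^sub>R g"
proof -
  have "transpose (mat 1 + (1 / (norm p)\<^sup>2) *\<^sub>R outer p g)
      = mat 1 + (1 / (norm p)\<^sup>2) *\<^sub>R outer g p"
    by (simp add: vec_eq_iff transpose_def outer_def mat_def)
  then show ?thesis
    unfolding transpose_map_def rank_one_factor_def matrix_of_matrix_vector_mul
    by (simp add: matrix_vector_mult_add_rdistrib outer_mult_vector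
        scaleR_matrix_vector_assoc[symmetric] power2_norm_eq_inner del: transpose_matrix_vector)
qed

lemma linear_rank_one_factor: "linear (rank_one_factor p g)"
  by (simp add: rank_one_factor_def)

lemma comp_maps_1: "comp_maps l (Suc 0) v = v"
  by (simp add: comp_maps_def)

lemma foldr_comp_snoc: "foldr (\<circ>) (fs @ [h]) id = foldr (\<circ>) fs id \<circ> h"
  by (induction fs) (auto simp: comp_assoc)

lemma comp_maps_Suc:
  assumes "k \<ge> 1"
  shows "comp_maps l (Suc k) v = comp_maps l k (l k v)"
  using assms foldr_comp_snoc[of "map l [1..<k]" "l k"] by (simp add: comp_maps_def)

lemma comp_transposes_1: "comp_transposes l (Suc 0) v = v"
  by (simp add: comp_transposes_def)

lemma comp_transposes_Suc:
  assumes "k \<ge> 1"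
  shows "comp_transposes l (Suc k) v = transpose_map (l k) (comp_transposes l k v)"
  using assms by (simp add: comp_transposes_def)

lemma linear_comp_maps:
  assumes "k \<ge> 1" and "\<And>j. 1 \<le> j \<Longrightarrow> j < k \<Longrightarrow> linear (l j)"
  shows "linear (comp_maps l k)"
  using assms
proof (induction k rule: dec_induct)
  case base
  then show ?case by (simp add: comp_maps_def linear_id[unfolded id_def])
next
  case (step i)
  have "comp_maps l (Suc i) = comp_maps l i \<circ> l i"
    using step.hyps by (simp add: fun_eq_iff comp_maps_Suc)
  moreover have "linear (comp_maps l i)" "linear (l i)"
    using step by auto
  ultimately show ?case
    by (simp add: linear_compose[unfolded o_def] o_def)
qed

lemma comp_maps_fixed:
  assumes "k \<ge> 1" and "\<And>j. 1 \<le> j \<Longrightarrow> j < k \<Longrightarrow> l j v = v"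
  shows "comp_maps l k v = v"
  using assms by (induction k rule: dec_induct) (auto simp: comp_maps_1 comp_maps_Suc)

lemma comp_transposes_fixed:
  assumes "k \<ge> 1" and "\<And>j. 1 \<le> j \<Longrightarrow> j < k \<Longrightarrow> transpose_map (l j) v = v"
  shows "comp_transposes l k v = v"
  using assms by (induction k rule: dec_induct) (auto simp: comp_transposes_1 comp_transposes_Suc)

section \<open>Orthogonality in the conjugate gradient method\<close>

locale conjugate_gradient =
  fixes A :: "real ^ 'n ^ 'n" and b x0 :: "real ^ 'n"
    and \<beta> :: "nat \<Rightarrow> real" and n :: "nat \<Rightarrow> real ^ 'n" and \<alpha> :: "nat \<Rightarrow> real"
    and x r :: "nat \<Rightarrow> real ^ 'n"
  assumes symmetric: "transpose A = A"
    and positive_definite: "\<And>v. v \<noteq> 0 \<Longrightarrow> v \<bullet> (A *v v) > 0"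
    and run: "linear_CG_run A b x0 \<beta> n \<alpha> x r"
begin

lemma direction_1: "r 0 \<noteq> 0 \<Longrightarrow> n (Suc 0) = r 0"
  using run unfolding linear_CG_run_def by auto

lemma direction_Suc:
  assumes "\<forall>j<Suc k. r j \<noteq> 0" and "k \<ge> 1"
  shows "n (Suc k) = ((r k \<bullet> r k) / (r (k - 1) \<bullet> r (k - 1))) *\<^sub>R n k + r k"
proof -
  have "Suc k - 2 = k - 1" by simp
  moreover have "\<beta> (Suc k) = (r (Suc k - 1) \<bullet> r (Suc k - 1)) / (r (Suc k - 2) \<bullet> r (Suc k - 2)) \<and>
      n (Suc k) = \<beta> (Suc k) *\<^sub>R n (Suc k - 1) + r (Suc k - 1)"
    using run assms unfolding linear_CG_run_def
    by (metis One_nat_def Suc_eq_plus1 le_add2 not_one_le_zero old.nat.inject)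
  ultimately show ?thesis by simp
qed

lemma step_Suc:
  assumes "\<forall>j<Suc k. r j \<noteq> 0"
  shows "\<alpha> (Suc k) = (r k \<bullet> r k) / (n (Suc k) \<bullet> (A *v n (Suc k)))"
    and "x (Suc k) = x k + \<alpha> (Suc k) *\<^sub>R n (Suc k)"
    and "r (Suc k) = r k - \<alpha> (Suc k) *\<^sub>R (A *v n (Suc k))"
  using run assms unfolding linear_CG_run_def by (metis diff_Suc_1 le_add1 plus_1_eq_Suc)+

lemma residual:
  assumes "\<forall>j<k. r j \<noteq> 0"
  shows "r k = b - A *v x k"
  using assms
proof (induction k)
  case 0
  then show ?case using run by (simp add: linear_CG_run_def)
next
  case (Suc k)
  then show ?case
    using step_Suc[of k] by (simp add: matrix_vector_right_distrib matrix_vector_mult_scaleR)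
qed

text \<open>The classical simultaneous induction: conjugacy of the new direction needs orthogonality of
  the residuals, because \<open>A *v n i\<close> is a multiple of \<open>r (i - 1) - r i\<close>; orthogonality of the new
  residual in turn needs conjugacy, because every earlier residual is a combination of
  directions.\<close>

lemma orthogonality:
  assumes "\<forall>j<k. r j \<noteq> 0"
  shows "\<And>i j. i < j \<Longrightarrow> j \<le> k \<Longrightarrow> r i \<bullet> r j = 0"
    and "\<And>i j. 1 \<le> i \<Longrightarrow> i < j \<Longrightarrow> j \<le> k \<Longrightarrow> n i \<bullet> (A *v n j) = 0"
    and "\<And>i j. 1 \<le> i \<Longrightarrow> i \<le> j \<Longrightarrow> j \<le> k \<Longrightarrow> n i \<bullet> r j = 0"
    and "\<And>j. j < k \<Longrightarrow> n (Suc j) \<bullet> r j = r j \<bullet> r j"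
proof -
  have "(\<forall>i j. i < j \<longrightarrow> j \<le> k \<longrightarrow> r i \<bullet> r j = 0) \<and>
    (\<forall>i j. 1 \<le> i \<longrightarrow> i < j \<longrightarrow> j \<le> k \<longrightarrow> n i \<bullet> (A *v n j) = 0) \<and>
    (\<forall>i j. 1 \<le> i \<longrightarrow> i \<le> j \<longrightarrow> j \<le> k \<longrightarrow> n i \<bullet> r j = 0) \<and>
    (\<forall>j<k. n (Suc j) \<bullet> r j = r j \<bullet> r j)"
    using assms
  proof (induction k)
    case 0
    then show ?case by simp
  next
    case (Suc k)
    then have nz: "r j \<noteq> 0" if "j < Suc k" for j using that by blast
    have rr: "r i \<bullet> r j = 0" if "i < j" "j \<le> k" for i j using Suc that by simp
    have nAn: "n i \<bullet> (A *v n j) = 0" if "1 \<le> i" "i < j" "j \<le> k" for i j using Suc that by simp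
    have nr: "n i \<bullet> r j = 0" if "1 \<le> i" "i \<le> j" "j \<le> k" for i j using Suc that by simp
    have nr1: "n (Suc j) \<bullet> r j = r j \<bullet> r j" if "j < k" for j using Suc that by simp
    \<comment> \<open>Positive curvature along the new direction comes from this product being nonzero.\<close>
    have nr1': "n (Suc j) \<bullet> r j = r j \<bullet> r j" if "j \<le> k" for j
    proof (cases "j = 0")
      case True
      then show ?thesis using direction_1 nz[of 0] by simp
    next
      case False
      then show ?thesis
        using that nz direction_Suc[of j] nr[of j j] by (simp add: inner_add_left)
    qed
    have pos: "n (Suc j) \<bullet> (A *v n (Suc j)) > 0" if "j \<le> k" for j
      using nr1'[OF that] nz[of j] that
      by (intro positive_definite) (auto simp: less_Suc_eq_le)
    have \<alpha>_pos: "\<alpha> (Suc j) > 0" if "j \<le> k" for j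
      using step_Suc(1)[of j] pos[OF that] nz that by simp
    have new_conj: "n i \<bullet> (A *v n (Suc k)) = 0" if i: "1 \<le> i" "i \<le> k" for i
    proof -
      obtain i' where i': "i = Suc i'" using i by (cases i) auto
      have "(A *v n i) \<bullet> r k = ((r i' - r i) \<bullet> r k) / \<alpha> i"
        using step_Suc(3)[of i'] nz i i' \<alpha>_pos[of i'] by simp
      then have "n i \<bullet> (A *v n (Suc k)) =
          ((r k \<bullet> r k) / (r (k - 1) \<bullet> r (k - 1))) * (n i \<bullet> (A *v n k))
          + (r i' \<bullet> r k - r i \<bullet> r k) / \<alpha> i"
        using direction_Suc[of k] nz i
        by (simp add: matrix_vector_right_distrib matrix_vector_mult_scaleR inner_add_right
            symmetric_inner[OF symmetric, of "n i" "r k"] inner_diff_left)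
      also have "\<dots> = 0"
      proof (cases "i = k")
        case True
        then show ?thesis
          using i' nz[of i'] step_Suc(1)[of i'] pos[of i'] rr[of i' k] nz True[symmetric] by simp
      next
        case False
        then show ?thesis using i i' rr[of i' k] rr[of i k] nAn[of i k] by simp
      qed
      finally show ?thesis .
    qed
    have new_nr: "n i \<bullet> r (Suc k) = 0" if i: "1 \<le> i" "i \<le> Suc k" for i
    proof (cases "i = Suc k")
      case True
      then show ?thesis
        using step_Suc(1,3)[of k] nz nr1'[of k] pos[of k] by (simp add: inner_diff_right)
    next
      case False
      then show ?thesis
        using step_Suc(3)[of k] nz nr[of i k] new_conj[of i] i by (simp add: inner_diff_right)
    qed
    have new_rr: "r i \<bullet> r (Suc k) = 0" if i: "i \<le> k" for i
    proof (cases "i = 0")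
      case True
      then show ?thesis using direction_1 nz[of 0] new_nr[of 1] by simp
    next
      case False
      then have "r i = n (Suc i) - ((r i \<bullet> r i) / (r (i - 1) \<bullet> r (i - 1))) *\<^sub>R n i"
        using direction_Suc[of i] nz i by simp
      then have "r i \<bullet> r (Suc k) =
          n (Suc i) \<bullet> r (Suc k) - (r i \<bullet> r i) / (r (i - 1) \<bullet> r (i - 1)) * (n i \<bullet> r (Suc k))"
        by (metis inner_diff_left inner_scaleR_left)
      then show ?thesis
        using new_nr[of i] new_nr[of "Suc i"] i False by simp
    qed
    show ?case
      using rr nAn nr nr1' new_conj new_nr new_rr by (auto simp: le_Suc_eq less_Suc_eq_le)
  qed
  then show "\<And>i j. i < j \<Longrightarrow> j \<le> k \<Longrightarrow> r i \<bullet> r j = 0"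
    and "\<And>i j. 1 \<le> i \<Longrightarrow> i < j \<Longrightarrow> j \<le> k \<Longrightarrow> n i \<bullet> (A *v n j) = 0"
    and "\<And>i j. 1 \<le> i \<Longrightarrow> i \<le> j \<Longrightarrow> j \<le> k \<Longrightarrow> n i \<bullet> r j = 0"
    and "\<And>j. j < k \<Longrightarrow> n (Suc j) \<bullet> r j = r j \<bullet> r j"
    by blast+
qed

text \<open>The CG step length is the exact line search step, since \<open>n (Suc k) \<bullet> r k = r k \<bullet> r k\<close>
  and the residual is the negative gradient.\<close>

lemma exact_line_search_iff:
  assumes nz: "\<forall>j<Suc k. r j \<noteq> 0"
    and f: "f = (\<lambda>x. 1 / 2 * (x \<bullet> (A *v x)) - b \<bullet> x)"
  shows "is_arg_min (\<lambda>a. f (x k + a *\<^sub>R n (Suc k))) (\<lambda>a. a \<ge> 0) a \<longleftrightarrow> a = \<alpha> (Suc k)"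
proof -
  have slope: "n (Suc k) \<bullet> (b - A *v x k) = r k \<bullet> r k"
    using orthogonality(4)[OF nz, of k] residual[of k] nz by simp
  moreover have "n (Suc k) \<noteq> 0"
    using orthogonality(4)[OF nz, of k] nz by auto
  ultimately show ?thesis
    using exact_line_search_quadratic[OF symmetric _ _ f, of "n (Suc k)" "x k"]
      positive_definite step_Suc(1)[OF nz] by simp
qed

lemma comp_transposes_gradient:
  assumes nz: "\<forall>j<i. r j \<noteq> 0"
    and l: "\<And>j. 1 \<le> j \<Longrightarrow> j \<le> k \<Longrightarrow> l j = rank_one_factor (r (j - 1)) (r j)"
    and "k \<le> i"
    and f: "f = (\<lambda>x. 1 / 2 * (x \<bullet> (A *v x)) - b \<bullet> x)"
  shows "- comp_transposes l (Suc k) (gradient f (x i)) = r i"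
proof -
  have "comp_transposes l (Suc k) (- r i) = - r i"
  proof (rule comp_transposes_fixed)
    fix j assume "1 \<le> j" "j < Suc k"
    moreover from this have "r (j - 1) \<bullet> r i = 0"
      using orthogonality(1)[OF nz, of "j - 1" i] \<open>k \<le> i\<close> by simp
    ultimately show "transpose_map (l j) (- r i) = - r i"
      using l[of j] by (simp add: transpose_map_rank_one_factor)
  qed simp
  moreover have "gradient f (x i) = - r i"
    using residual[OF nz] gradient_quadratic[OF symmetric, of b "x i"] f by simp
  ultimately show ?thesis by simp
qed

text \<open>The factor \<open>l k\<close> turns \<open>r k\<close> into \<open>r k\<close> plus the CG coefficient times \<open>r (k - 1)\<close>.
  The remaining factors fix \<open>r k\<close> and, inductively, turn \<open>r (k - 1)\<close> into \<open>n k\<close>: together this is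
  the CG recurrence for the directions.\<close>

lemma comp_maps_residual:
  assumes "\<forall>j<Suc k. r j \<noteq> 0"
    and "\<And>j. 1 \<le> j \<Longrightarrow> j \<le> k \<Longrightarrow> l j = rank_one_factor (r (j - 1)) (r j)"
  shows "comp_maps l (Suc k) (r k) = n (Suc k)"
  using assms
proof (induction k)
  case 0
  then show ?case using direction_1 by (simp add: comp_maps_1)
next
  case (Suc k)
  let ?c = "(r (Suc k) \<bullet> r (Suc k)) / (r k \<bullet> r k)"
  have "linear (comp_maps l (Suc k))"
    by (intro linear_comp_maps) (auto simp: Suc.prems(2) linear_rank_one_factor)
  moreover have "l (Suc k) (r (Suc k)) = r (Suc k) + ?c *\<^sub>R r k"
    using Suc.prems(2)[of "Suc k"] by (simp add: rank_one_factor_apply)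
  ultimately have "comp_maps l (Suc (Suc k)) (r (Suc k)) =
      comp_maps l (Suc k) (r (Suc k)) + ?c *\<^sub>R comp_maps l (Suc k) (r k)"
    by (simp add: comp_maps_Suc linear_add linear_cmul)
  also have "comp_maps l (Suc k) (r (Suc k)) = r (Suc k)"
  proof (rule comp_maps_fixed)
    fix j assume "1 \<le> j" "j < Suc k"
    then show "l j (r (Suc k)) = r (Suc k)"
      using Suc.prems(2)[of j] orthogonality(1)[OF Suc.prems(1), of j "Suc k"]
      by (simp add: rank_one_factor_apply)
  qed simp
  also have "comp_maps l (Suc k) (r k) = n (Suc k)"
    using Suc by simp
  finally show ?case
    using direction_Suc[OF Suc.prems(1)] by (simp add: add.commute)
qed

section \<open>Comparison of the two runs\<close>

text \<open>Only the residual at which CG stops can vanish among those considered, and there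
  \<open>comp_transposes_gradient\<close> still applies; so the rule for \<open>p\<close> also holds at the step where
  Algorithm 2 terminates.\<close>

lemma algorithm2_run_from_CG:
  assumes f: "f = (\<lambda>x. 1 / 2 * (x \<bullet> (A *v x)) - b \<bullet> x)"
  shows "algorithm2_run f x0 (\<lambda>k. r (k - 1)) n \<alpha> x r (\<lambda>k. rank_one_factor (r (k - 1)) (r k))"
    (is "algorithm2_run _ _ ?p _ _ _ _ ?l")
  unfolding algorithm2_run_def
proof (intro conjI allI impI)
  show "x 0 = x0" using run by (simp add: linear_CG_run_def)
next
  fix k :: nat assume k: "k \<ge> 1" and p: "\<forall>j\<in>{1..<k}. ?p j \<noteq> 0"
  obtain k' where k': "k = Suc k'" using k by (cases k) auto
  have nz: "\<forall>j<k'. r j \<noteq> 0"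
  proof (intro allI impI)
    fix j assume "j < k'"
    then show "r j \<noteq> 0" using p[rule_format, of "Suc j"] k' by simp
  qed
  show "?p k = - comp_transposes ?l k (gradient f (x (k - 1)))"
    using comp_transposes_gradient[OF nz _ _ f, of k' ?l] k' by simp
  assume "?p k \<noteq> 0"
  then have nz': "\<forall>j<Suc k'. r j \<noteq> 0"
    using nz k' by (simp add: less_Suc_eq)
  show "n k = comp_maps ?l k (?p k)"
    using comp_maps_residual[OF nz', of ?l] k' by simp
  show "is_arg_min (\<lambda>a. f (x (k - 1) + a *\<^sub>R n k)) (\<lambda>a. a \<ge> 0) (\<alpha> k)"
    using exact_line_search_iff[OF nz' f] k' by simp
  show "x k = x (k - 1) + \<alpha> k *\<^sub>R n k"
    using step_Suc(2)[OF nz'] k' by simp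
  show "r k = - comp_transposes ?l k (gradient f (x k))"
    using comp_transposes_gradient[OF nz' _ _ f, of k' ?l] k' by simp
  show "?l k = (\<lambda>v. (mat 1 + (1 / (norm (?p k))\<^sup>2) *\<^sub>R outer (?p k) (r k)) *v v)"
    by (simp add: rank_one_factor_def)
qed

text \<open>The conclusion includes \<open>p (Suc k) = r k\<close> without assuming \<open>r k \<noteq> 0\<close>: this is what makes
  both methods stop at the same step.\<close>

lemma algorithm2_run_unique:
  assumes f: "f = (\<lambda>x. 1 / 2 * (x \<bullet> (A *v x)) - b \<bullet> x)"
    and run2: "algorithm2_run f x0 p m \<alpha>2 x2 g l"
    and "\<forall>j<k. r j \<noteq> 0"
  shows "x2 k = x k \<and> p (Suc k) = r k \<and>
    (\<forall>i\<in>{1..k}. p i = r (i - 1) \<and> m i = n i \<and> g i = r i \<and> \<alpha>2 i = \<alpha> i \<and>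
       l i = rank_one_factor (r (i - 1)) (r i))"
  using assms(3)
proof (induction k)
  case 0
  have "x2 0 = x 0"
    using run run2 by (simp add: linear_CG_run_def algorithm2_run_def)
  moreover have "p (Suc 0) = - comp_transposes l (Suc 0) (gradient f (x2 0))"
    using run2[unfolded algorithm2_run_def, THEN conjunct2, rule_format, of "Suc 0"] by simp
  ultimately show ?case
    using comp_transposes_gradient[of 0 0 l, OF _ _ _ f] by simp
next
  case (Suc k)
  then have IH: "x2 k = x k" "p (Suc k) = r k"
    "\<And>i. 1 \<le> i \<Longrightarrow> i \<le> k \<Longrightarrow> p i = r (i - 1) \<and> m i = n i \<and> g i = r i \<and> \<alpha>2 i = \<alpha> i \<and>
       l i = rank_one_factor (r (i - 1)) (r i)"
    by auto
  have p: "p i = r (i - 1)" if "1 \<le> i" "i \<le> Suc k" for i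
    using that IH(2) IH(3)[of i] by (cases "i = Suc k") auto
  have p_nz: "p i \<noteq> 0" if "1 \<le> i" "i \<le> Suc k" for i
    using p[OF that] that Suc.prems by simp
  note step2 = run2[unfolded algorithm2_run_def, THEN conjunct2, rule_format]
  have new: "m (Suc k) = comp_maps l (Suc k) (p (Suc k))"
    "is_arg_min (\<lambda>a. f (x2 k + a *\<^sub>R m (Suc k))) (\<lambda>a. a \<ge> 0) (\<alpha>2 (Suc k))"
    "x2 (Suc k) = x2 k + \<alpha>2 (Suc k) *\<^sub>R m (Suc k)"
    "g (Suc k) = - comp_transposes l (Suc k) (gradient f (x2 (Suc k)))"
    "l (Suc k) = rank_one_factor (p (Suc k)) (g (Suc k))"
    using step2[of "Suc k"] p_nz by (auto simp: rank_one_factor_def)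
  have m: "m (Suc k) = n (Suc k)"
    using comp_maps_residual[OF Suc.prems, of l] IH new(1) by simp
  have \<alpha>: "\<alpha>2 (Suc k) = \<alpha> (Suc k)"
    using new(2) exact_line_search_iff[OF Suc.prems f] m IH(1) by simp
  have x: "x2 (Suc k) = x (Suc k)"
    using new(3) m \<alpha> IH(1) step_Suc(2)[OF Suc.prems] by simp
  have g: "g (Suc k) = r (Suc k)"
    using new(4) x comp_transposes_gradient[OF Suc.prems _ _ f, of k l] IH(3) by simp
  have l: "l i = rank_one_factor (r (i - 1)) (r i)" if "1 \<le> i" "i \<le> Suc k" for i
    using that new(5) IH g by (cases "i = Suc k") auto
  have "p (Suc (Suc k)) = - comp_transposes l (Suc (Suc k)) (gradient f (x2 (Suc k)))"
    using step2[of "Suc (Suc k)"] p_nz by auto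
  then have "p (Suc (Suc k)) = r (Suc k)"
    using x comp_transposes_gradient[OF Suc.prems _ _ f, of "Suc k" l] l by simp
  then show ?case
    using x m \<alpha> g l IH by (auto simp: le_Suc_eq)
qed

lemma same_termination:
  assumes f: "f = (\<lambda>x. 1 / 2 * (x \<bullet> (A *v x)) - b \<bullet> x)"
    and run2: "algorithm2_run f x0 p m \<alpha>2 x2 g l"
  shows "(\<forall>j\<in>{1..k}. p j \<noteq> 0) \<longleftrightarrow> (\<forall>j<k. r j \<noteq> 0)"
proof (induction k)
  case 0
  then show ?case by simp
next
  case (Suc k)
  have "(\<forall>j\<in>{1..Suc k}. p j \<noteq> 0) \<longleftrightarrow> (\<forall>j\<in>{1..k}. p j \<noteq> 0) \<and> p (Suc k) \<noteq> 0"
    by (simp add: atLeastAtMostSuc_conv conj_commute)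
  also have "\<dots> \<longleftrightarrow> (\<forall>j<k. r j \<noteq> 0) \<and> r k \<noteq> 0"
    using Suc.IH algorithm2_run_unique[OF f run2, of k] by metis
  also have "\<dots> \<longleftrightarrow> (\<forall>j<Suc k. r j \<noteq> 0)"
    by (auto simp: less_Suc_eq)
  finally show ?case .
qed

end

section \<open>Existence of runs and equivalence\<close>

text \<open>The components are the direction, the iterate, the residual and the coefficient of the
  next recurrence. Starting from the direction \<open>0\<close> makes the first step, whose direction is
  the residual itself, an instance of the general recurrence.\<close>

primrec CG_state ::
  "real ^ 'n ^ 'n \<Rightarrow> real ^ 'n \<Rightarrow> real ^ 'n \<Rightarrow> nat \<Rightarrow>
    (real ^ 'n) \<times> (real ^ 'n) \<times> (real ^ 'n) \<times> real"
where
  "CG_state A b x0 0 = (0, x0, b - A *v x0, 0)"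
| "CG_state A b x0 (Suc k) =
    (case CG_state A b x0 k of (n, x, r, \<beta>) \<Rightarrow>
      let n' = \<beta> *\<^sub>R n + r;
          \<alpha> = (r \<bullet> r) / (n' \<bullet> (A *v n'));
          r' = r - \<alpha> *\<^sub>R (A *v n')
      in (n', x + \<alpha> *\<^sub>R n', r', (r' \<bullet> r') / (r \<bullet> r)))"

lemma linear_CG_run_exists: "\<exists>\<beta> n \<alpha> x r. linear_CG_run A b x0 \<beta> n \<alpha> x r"
proof -
  define n x r \<beta> \<alpha> where
    n_def: "n k = fst (CG_state A b x0 k)" and
    x_def: "x k = fst (snd (CG_state A b x0 k))" and
    r_def: "r k = fst (snd (snd (CG_state A b x0 k)))" and
    \<beta>_def: "\<beta> k = snd (snd (snd (CG_state A b x0 (k - 1))))" and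
    \<alpha>_def: "\<alpha> k = (r (k - 1) \<bullet> r (k - 1)) / (n k \<bullet> (A *v n k))" for k
  have start: "n 0 = 0" "x 0 = x0" "r 0 = b - A *v x0"
    by (simp_all add: n_def x_def r_def)
  have step: "n (Suc k) = \<beta> (Suc k) *\<^sub>R n k + r k"
    "x (Suc k) = x k + \<alpha> (Suc k) *\<^sub>R n (Suc k)"
    "r (Suc k) = r k - \<alpha> (Suc k) *\<^sub>R (A *v n (Suc k))"
    "\<beta> (Suc (Suc k)) = (r (Suc k) \<bullet> r (Suc k)) / (r k \<bullet> r k)" for k
    by (simp_all add: n_def x_def r_def \<beta>_def \<alpha>_def Let_def split: prod.split)
  have "linear_CG_run A b x0 \<beta> n \<alpha> x r"
    unfolding linear_CG_run_def
  proof (intro conjI allI impI)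
    fix k :: nat assume "k \<ge> 1"
    then obtain k' where k: "k = Suc k'" by (cases k) auto
    show "if k = 1 then n 1 = r 0
         else \<beta> k = (r (k - 1) \<bullet> r (k - 1)) / (r (k - 2) \<bullet> r (k - 2)) \<and>
              n k = \<beta> k *\<^sub>R n (k - 1) + r (k - 1)"
      using step(1,4) start k by (cases k') auto
  qed (use start step in \<open>auto simp: \<alpha>_def gr0_conv_Suc Suc_le_eq\<close>)
  then show ?thesis by blast
qed

theorem mainTheorem1:
  fixes A :: "real ^ 'n ^ 'n" and b x0 :: "real ^ 'n" and f :: "real ^ 'n \<Rightarrow> real"
  assumes symmetric: "transpose A = A"
    and positive_definite: "\<And>v. v \<noteq> 0 \<Longrightarrow> v \<bullet> (A *v v) > 0"
    and f: "f = (\<lambda>x. 1 / 2 * (x \<bullet> (A *v x)) - b \<bullet> x)"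
  shows
    "(\<exists>p m \<alpha> x g l. algorithm2_run f x0 p m \<alpha> x g l) \<and>
     (\<exists>\<beta> n \<alpha> x r. linear_CG_run A b x0 \<beta> n \<alpha> x r) \<and>
     (\<forall>p m \<alpha> x g l \<beta> n \<alpha>' x' r.
        algorithm2_run f x0 p m \<alpha> x g l \<longrightarrow> linear_CG_run A b x0 \<beta> n \<alpha>' x' r \<longrightarrow>
          (\<forall>k. (\<forall>j\<in>{1..k}. p j \<noteq> 0) \<longleftrightarrow> (\<forall>j<k. r j \<noteq> 0)) \<and>
          (\<forall>k. (\<forall>j<k. r j \<noteq> 0) \<longrightarrow> x k = x' k) \<and>
          (\<forall>k\<ge>1. (\<forall>j<k. r j \<noteq> 0) \<longrightarrow>
             p k = r (k - 1) \<and> m k = n k \<and> g k = r k \<and> \<alpha> k = \<alpha>' k))"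
proof -
  have CG: "conjugate_gradient A b x0 \<beta> n \<alpha> x r" if "linear_CG_run A b x0 \<beta> n \<alpha> x r"
    for \<beta> n \<alpha> x r
    using that symmetric positive_definite by unfold_locales
  obtain \<beta>0 n0 \<alpha>0 y r0 where run0: "linear_CG_run A b x0 \<beta>0 n0 \<alpha>0 y r0"
    using linear_CG_run_exists by blast
  have exists2: "\<exists>p m \<alpha> x g l. algorithm2_run f x0 p m \<alpha> x g l"
    by (intro exI) (rule conjugate_gradient.algorithm2_run_from_CG[OF CG[OF run0] f])
  have agree: "(\<forall>k. (\<forall>j\<in>{1..k}. p j \<noteq> 0) \<longleftrightarrow> (\<forall>j<k. r j \<noteq> 0)) \<and>
      (\<forall>k. (\<forall>j<k. r j \<noteq> 0) \<longrightarrow> x k = x' k) \<and>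
      (\<forall>k\<ge>1. (\<forall>j<k. r j \<noteq> 0) \<longrightarrow> p k = r (k - 1) \<and> m k = n k \<and> g k = r k \<and> \<alpha> k = \<alpha>' k)"
    if run2: "algorithm2_run f x0 p m \<alpha> x g l" and run: "linear_CG_run A b x0 \<beta> n \<alpha>' x' r"
    for p m \<alpha> x g l \<beta> n \<alpha>' x' r
  proof -
    interpret conjugate_gradient A b x0 \<beta> n \<alpha>' x' r
      by (rule CG[OF run])
    show ?thesis
      using same_termination[OF f run2] algorithm2_run_unique[OF f run2] by simp
  qed
  show ?thesis
    by (rule conjI[OF exists2 conjI[OF linear_CG_run_exists]], intro allI impI) (rule agree)
qed

end
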